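(* For every graph $G$, as $t\to\infty$, $\pi_t^*(G)\in \hat{\pi}^*(G)\,t+\Theta(1)$; that is, $\pi_t^*(G)-\hat{\pi}^*(G)\,t$ is bounded by a constant independent of $t$.
   Context: Graphs are finite simple graphs. A distribution on a graph $G=(V,E)$ is a function $D:V\to\mathbb{N}$, with size $|D|=\sum_v D(v)$. A pebbling move removes two pebbles from a vertex having at least two pebbles and places one pebble on a neighbor. A distribution $D$ is $t$-solvable if for every vertex $v$, some sequence of pebbling moves starting from $D$ results in a distribution with at least $t$ pebbles on $v$. The optimal $t$-pebbling number $\pi_t^*(G)$ is the minimum size of a $t$-solvable distribution on $G$. The optimal fractional pebbling number is $\hat{\pi}^*(G)=\liminf_{t\to\infty}\pi_t^*(G)/t$. *)

theory Defs
  imports "Graph_Theory.Pair_Digraph" "HOL-Library.Extended_Real"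
begin

text \<open>
  Finite simple graphs are the models of the locale \<^locale>\<open>pair_graph\<close>: a finite vertex set
  with a symmetric, irreflexive adjacency relation \<^const>\<open>parcs\<close>, each edge being represented
  by its two orientations. The graph may be disconnected, and the null graph is allowed.
\<close>

text \<open>
  A distribution \<open>V \<rightarrow> \<nat>\<close> is encoded as a function on the whole type that vanishes outside \<open>V\<close>.
\<close>

definition distributions :: "'a pair_pre_digraph \<Rightarrow> ('a \<Rightarrow> nat) set" where
  "distributions G = {D. \<forall>v. v \<notin> pverts G \<longrightarrow> D v = 0}"

definition dist_size :: "'a pair_pre_digraph \<Rightarrow> ('a \<Rightarrow> nat) \<Rightarrow> nat" where
  "dist_size G D = (\<Sum>v\<in>pverts G. D v)"

text \<open>
  Since there are no loops, the two updated vertices are distinct.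
\<close>

definition pebbling_move :: "'a pair_pre_digraph \<Rightarrow> ('a \<Rightarrow> nat) \<Rightarrow> ('a \<Rightarrow> nat) \<Rightarrow> bool" where
  "pebbling_move G D D' \<longleftrightarrow>
     (\<exists>u v. (u, v) \<in> parcs G \<and> D u \<ge> 2 \<and> D' = D(u := D u - 2, v := D v + 1))"

definition t_solvable :: "'a pair_pre_digraph \<Rightarrow> nat \<Rightarrow> ('a \<Rightarrow> nat) \<Rightarrow> bool" where
  "t_solvable G t D \<longleftrightarrow>
     (\<forall>v\<in>pverts G. \<exists>D'. (pebbling_move G)\<^sup>*\<^sup>* D D' \<and> D' v \<ge> t)"

definition optimal_pebbling_number :: "'a pair_pre_digraph \<Rightarrow> nat \<Rightarrow> nat" where
  "optimal_pebbling_number G t =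
     (LEAST n. \<exists>D\<in>distributions G. t_solvable G t D \<and> dist_size G D = n)"

text \<open>
  The limit inferior is taken in the extended reals, so that no finiteness is presupposed; the
  value of the quotient at \<open>t = 0\<close> is irrelevant.
\<close>

definition optimal_fractional_pebbling_number :: "'a pair_pre_digraph \<Rightarrow> ereal" where
  "optimal_fractional_pebbling_number G =
     liminf (\<lambda>t. ereal (real (optimal_pebbling_number G t) / real t))"

end

theory Submission
  imports Defs
begin

text \<open>
  A sequence of moves determines a flow counting how often each arc is used, and a solution is
  recorded by a linear balance condition on this flow. Conversely, an integral flow whose final
  balance is at least one at every vertex can be executed greedily in some order. Linear
  conditions can be rescaled: multiplying an \<open>m\<close>-solvable distribution and its flows by \<open>t / m\<close>,
  rounding, and adding a constant number of pebbles to every vertex to absorb the rounding errors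
  gives a \<open>t\<close>-solvable distribution, whence \<open>\<pi>\<^sub>t \<le> (t / m) \<pi>\<^sub>m + C\<close> for all \<open>t\<close> and all \<open>m > 0\<close>.
  Letting either index tend to infinity gives both bounds.
\<close>

section \<open>Flows on arcs and their realisation by moves\<close>

definition outflow :: "'a pair_pre_digraph \<Rightarrow> ('a \<times> 'a \<Rightarrow> nat) \<Rightarrow> 'a \<Rightarrow> nat" where
  "outflow G x u = (\<Sum>a\<in>{a \<in> parcs G. fst a = u}. x a)"

definition inflow :: "'a pair_pre_digraph \<Rightarrow> ('a \<times> 'a \<Rightarrow> nat) \<Rightarrow> 'a \<Rightarrow> nat" where
  "inflow G x u = (\<Sum>a\<in>{a \<in> parcs G. snd a = u}. x a)"

lemma sum_fun_upd_Suc: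
  fixes x :: "'b \<Rightarrow> nat"
  assumes "finite A"
  shows "sum (x(a := Suc (x a))) A = sum x A + (if a \<in> A then 1 else 0)"
proof -
  have "sum (x(a := Suc (x a))) A = (\<Sum>b\<in>A. x b + (if b = a then 1 else 0))"
    by (rule sum.cong) auto
  then show ?thesis
    using assms by (simp add: sum.distrib)
qed

context pair_graph
begin

lemma outflow_upd_Suc:
  assumes "a \<in> parcs G"
  shows "outflow G (x(a := Suc (x a))) u = outflow G x u + (if u = fst a then 1 else 0)"
  using assms sum_fun_upd_Suc[of "{a \<in> parcs G. fst a = u}" x a] unfolding outflow_def by auto

lemma inflow_upd_Suc:
  assumes "a \<in> parcs G"
  shows "inflow G (x(a := Suc (x a))) u = inflow G x u + (if u = snd a then 1 else 0)"
  using assms sum_fun_upd_Suc[of "{a \<in> parcs G. snd a = u}" x a] unfolding inflow_def by auto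

lemma sum_outflow: "(\<Sum>u\<in>pverts G. outflow G x u) = sum x (parcs G)"
  unfolding outflow_def by (rule sum.group) (auto intro: in_arcsD1)

lemma sum_inflow: "(\<Sum>u\<in>pverts G. inflow G x u) = sum x (parcs G)"
  unfolding inflow_def by (rule sum.group) (auto intro: in_arcsD2)

text \<open>Let \<open>x\<close> count the uses of each arc; the order of the moves is forgotten.
  The balance is kept additive to avoid truncated subtraction.\<close>

lemma moves_imp_flow:
  assumes "(pebbling_move G)\<^sup>*\<^sup>* D D'"
  shows "\<exists>x. \<forall>u. D' u + 2 * outflow G x u = D u + inflow G x u"
  using assms
proof induction
  case base
  show ?case
    by (intro exI[of _ "\<lambda>_. 0"]) (simp add: outflow_def inflow_def)
next
  case (step D' D'')
  then obtain x where x: "D' u + 2 * outflow G x u = D u + inflow G x u" for u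
    by blast
  obtain u v where uv: "(u, v) \<in> parcs G" "D' u \<ge> 2" "D'' = D'(u := D' u - 2, v := D' v + 1)"
    using step.hyps(2) unfolding pebbling_move_def by blast
  have "u \<noteq> v"
    using uv(1) pair_no_loops by fastforce
  have "D'' w + 2 * outflow G (x((u, v) := Suc (x (u, v)))) w
      = D w + inflow G (x((u, v) := Suc (x (u, v)))) w" for w
    using x[of w] uv(2,3) \<open>u \<noteq> v\<close> by (auto simp: outflow_upd_Suc[OF uv(1)] inflow_upd_Suc[OF uv(1)])
  then show ?case
    by blast
qed

text \<open>
  The strict slack excludes deadlock: if no vertex that still has to send a pebble held two
  pebbles, the inflow would be at least twice the outflow at every vertex, which is impossible
  in total unless the flow is zero.
\<close>

lemma flow_imp_moves:
  assumes "\<And>u. u \<in> pverts G \<Longrightarrow> 2 * outflow G x u < D u + inflow G x u"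
  shows "\<exists>D'. (pebbling_move G)\<^sup>*\<^sup>* D D' \<and> (\<forall>u. D' u + 2 * outflow G x u = D u + inflow G x u)"
  using assms
proof (induction "sum x (parcs G)" arbitrary: x D)
  case 0
  then have "x a = 0" if "a \<in> parcs G" for a
    using that by simp
  then show ?case
    by (intro exI[of _ D]) (auto simp: outflow_def inflow_def)
next
  case (Suc k)
  have "\<exists>u\<in>pverts G. outflow G x u > 0 \<and> D u \<ge> 2"
  proof (rule ccontr)
    assume "\<not> ?thesis"
    then have *: "D u < 2" if "u \<in> pverts G" "outflow G x u > 0" for u
      using that by force
    \<comment> \<open>If the outflow is positive, then \<open>D u\<close> is at most 1, and the
      strict slack leaves no room for it in the inequality.\<close>
    have "2 * outflow G x u \<le> inflow G x u" if "u \<in> pverts G" for u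
      using *[OF that] Suc.prems[OF that] by (cases "outflow G x u = 0") auto
    then have "(\<Sum>u\<in>pverts G. 2 * outflow G x u) \<le> (\<Sum>u\<in>pverts G. inflow G x u)"
      by (rule sum_mono)
    then have "2 * sum x (parcs G) \<le> sum x (parcs G)"
      by (simp add: sum_distrib_left[symmetric] sum_outflow sum_inflow)
    then show False
      using Suc.hyps(2) by simp
  qed
  then obtain u where u: "u \<in> pverts G" "outflow G x u > 0" "D u \<ge> 2"
    by blast
  obtain a where "a \<in> {a \<in> parcs G. fst a = u}" "x a \<noteq> 0"
    using u(2) unfolding outflow_def
    by (elim sum.not_neutral_contains_not_neutral[OF less_imp_neq[THEN not_sym]])
  then obtain v where a: "(u, v) \<in> parcs G" "x (u, v) > 0"
    by (cases a) auto
  define y where "y = x((u, v) := x (u, v) - 1)"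
  define E where "E = D(u := D u - 2, v := D v + 1)"
  have x_eq: "x = y((u, v) := Suc (y (u, v)))"
    using a(2) by (auto simp: y_def)
  have "u \<noteq> v"
    using a(1) pair_no_loops by fastforce
  note flow = outflow_upd_Suc[OF a(1), of y, folded x_eq] inflow_upd_Suc[OF a(1), of y, folded x_eq]
  have move: "pebbling_move G D E"
    using a(1) u(3) unfolding pebbling_move_def E_def by blast
  have "k = sum y (parcs G)"
    using Suc.hyps(2) sum_fun_upd_Suc[of "parcs G" y "(u, v)", folded x_eq] a(1) by simp
  \<comment> \<open>Performing the move and deleting it from the flow preserves the slack exactly:
    at \<open>u\<close> both sides drop by 2, while at \<open>v\<close> the new pebble replaces one
    unit of inflow.\<close>
  moreover have "2 * outflow G y w < E w + inflow G y w" if "w \<in> pverts G" for w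
    using Suc.prems[OF that] u(3) \<open>u \<noteq> v\<close> by (auto simp: flow E_def split: if_splits)
  ultimately obtain D' where D': "(pebbling_move G)\<^sup>*\<^sup>* E D'"
      "\<And>w. D' w + 2 * outflow G y w = E w + inflow G y w"
    using Suc.hyps(1) by blast
  have "D' w + 2 * outflow G x w = D w + inflow G x w" for w
    using D'(2)[of w] u(3) \<open>u \<noteq> v\<close> by (auto simp: flow E_def split: if_splits)
  then show ?case
    using converse_rtranclp_into_rtranclp[of "pebbling_move G", OF move D'(1)] by blast
qed

section \<open>Rescaling optimal distributions\<close>

lemma optimal_pebbling_number_le:
  assumes "D \<in> distributions G" "t_solvable G t D"
  shows "optimal_pebbling_number G t \<le> dist_size G D"
  unfolding optimal_pebbling_number_def using assms by (intro Least_le) blast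

lemma optimal_pebbling_number_attained:
  obtains D where "D \<in> distributions G" "t_solvable G t D"
    "dist_size G D = optimal_pebbling_number G t"
proof -
  let ?D = "\<lambda>v. if v \<in> pverts G then t else 0"
  have "?D \<in> distributions G" "t_solvable G t ?D"
    by (auto simp: distributions_def t_solvable_def intro!: exI[of _ ?D])
  then have "\<exists>n. \<exists>D\<in>distributions G. t_solvable G t D \<and> dist_size G D = n"
    by blast
  from LeastI_ex[OF this] that show thesis
    unfolding optimal_pebbling_number_def by blast
qed

lemma optimal_pebbling_number_scale:
  fixes t m :: nat
  assumes "m > 0"
  shows "real (optimal_pebbling_number G t)
    \<le> real t / real m * real (optimal_pebbling_number G m)
      + real (card (pverts G) * (card (parcs G) + 2))"
proof -
  define r where "r = real t / real m"
  have r: "r \<ge> 0" "r * real m = real t"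
    using assms by (auto simp: r_def)
  obtain D where D: "D \<in> distributions G" "t_solvable G m D"
      "dist_size G D = optimal_pebbling_number G m"
    by (rule optimal_pebbling_number_attained)
  \<comment> \<open>\<open>E\<close> must serve all targets at once, so the surplus is uniform:
    \<open>card (parcs G)\<close> covers the inflow lost by rounding, and the extra 1 provides the
    strict slack required by \<open>flow_imp_moves\<close>.\<close>
  define E where
    "E v = (if v \<in> pverts G then nat \<lceil>r * real (D v)\<rceil> + (card (parcs G) + 1) else 0)" for v
  have E_ge: "real (E v) \<ge> r * real (D v) + real (card (parcs G)) + 1" if "v \<in> pverts G" for v
    using that r(1) by (simp add: E_def)
  have E_le: "real (E v) \<le> r * real (D v) + real (card (parcs G) + 2)" if "v \<in> pverts G" for v
  proof -
    have "real (nat \<lceil>r * real (D v)\<rceil>) \<le> r * real (D v) + 1"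
      using r(1) by simp
    then show ?thesis
      using that by (simp add: E_def)
  qed
  have "t_solvable G t E"
    unfolding t_solvable_def
  proof
    fix v assume v: "v \<in> pverts G"
    then obtain D' where D': "(pebbling_move G)\<^sup>*\<^sup>* D D'" "D' v \<ge> m"
      using D(2) unfolding t_solvable_def by blast
    obtain x where x: "\<And>u. D' u + 2 * outflow G x u = D u + inflow G x u"
      using moves_imp_flow[OF D'(1)] by blast
    \<comment> \<open>Rounding down can only lower the outflow, which helps; the inflow loses at
      most one unit per incoming arc.\<close>
    define y where "y a = nat \<lfloor>r * real (x a)\<rfloor>" for a
    have y: "real (y a) \<le> r * real (x a)" "r * real (x a) - 1 \<le> real (y a)" for a
      using r(1) unfolding y_def by simp_all
    have out: "real (outflow G y u) \<le> r * real (outflow G x u)" for u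
      unfolding outflow_def by (simp add: sum_distrib_left sum_mono y(1))
    have inn: "r * real (inflow G x u) - real (card (parcs G)) \<le> real (inflow G y u)" for u
    proof -
      let ?A = "{a \<in> parcs G. snd a = u}"
      have "(\<Sum>a\<in>?A. r * real (x a) - 1) \<le> (\<Sum>a\<in>?A. real (y a))"
        by (rule sum_mono) (rule y(2))
      moreover have "card ?A \<le> card (parcs G)"
        by (rule card_mono) auto
      ultimately show ?thesis
        unfolding inflow_def by (simp add: sum_subtractf sum_distrib_left)
    qed
    \<comment> \<open>Used twice: the summand 1 makes the flow executable, and at \<open>v\<close>
      the term \<open>r * real (D' u)\<close> guarantees \<open>t\<close> final pebbles.\<close>
    have balance: "r * real (D' u) + 1 + 2 * real (outflow G y u) \<le> real (E u) + real (inflow G y u)"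
      if "u \<in> pverts G" for u
    proof -
      have "real (D' u) + 2 * real (outflow G x u) = real (D u) + real (inflow G x u)"
        using arg_cong[OF x[of u], of real] by simp
      then have "r * real (D' u) + 2 * (r * real (outflow G x u))
          = r * real (D u) + r * real (inflow G x u)"
        by (metis distrib_left mult.left_commute)
      then show ?thesis
        using out[of u] inn[of u] E_ge[OF that] by linarith
    qed
    have "2 * outflow G y u < E u + inflow G y u" if "u \<in> pverts G" for u
    proof -
      have "0 \<le> r * real (D' u)"
        using r(1) by simp
      then have "real (2 * outflow G y u) < real (E u + inflow G y u)"
        using balance[OF that] by simp
      then show ?thesis
        by linarith
    qed
    then obtain E' where E': "(pebbling_move G)\<^sup>*\<^sup>* E E'"
        "\<And>u. E' u + 2 * outflow G y u = E u + inflow G y u"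
      using flow_imp_moves by blast
    have "real t \<le> r * real (D' v)"
      using r D'(2) by (metis mult_left_mono of_nat_le_iff)
    moreover have "real (E' v) + 2 * real (outflow G y v) = real (E v) + real (inflow G y v)"
      using arg_cong[OF E'(2)[of v], of real] by simp
    ultimately have "t \<le> E' v"
      using balance[OF v] by linarith
    then show "\<exists>E'. (pebbling_move G)\<^sup>*\<^sup>* E E' \<and> t \<le> E' v"
      using E'(1) by blast
  qed
  moreover have "E \<in> distributions G"
    by (simp add: distributions_def E_def)
  ultimately have "real (optimal_pebbling_number G t) \<le> real (dist_size G E)"
    using optimal_pebbling_number_le by simp
  also have "\<dots> \<le> (\<Sum>v\<in>pverts G. r * real (D v) + real (card (parcs G) + 2))"
    unfolding dist_size_def of_nat_sum by (rule sum_mono) (rule E_le)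
  also have "\<dots> = r * real (optimal_pebbling_number G m)
      + real (card (pverts G) * (card (parcs G) + 2))"
    by (simp add: distrib_left sum.distrib sum_distrib_left[symmetric] D(3)[symmetric] dist_size_def)
  finally show ?thesis
    by (simp add: r_def)
qed

end

section \<open>Passage to the limit\<close>

theorem theorem4p5:
  fixes G :: "'a pair_pre_digraph"
  assumes "pair_graph G"
  shows "\<exists>C::real. \<forall>t::nat.
    \<bar>ereal (real (optimal_pebbling_number G t))
      - optimal_fractional_pebbling_number G * ereal (real t)\<bar> \<le> ereal C"
proof -
  interpret pair_graph G by fact
  define p where "p t = real (optimal_pebbling_number G t)" for t
  define C where "C = real (card (pverts G) * (card (parcs G) + 2))"
  have scale: "p t \<le> real t / real m * p m + C" if "m > 0" for t m
    using optimal_pebbling_number_scale[OF that] by (simp add: p_def C_def)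
  let ?L = "optimal_fractional_pebbling_number G"
  have L_def: "?L = liminf (\<lambda>m. ereal (p m / real m))"
    by (simp add: optimal_fractional_pebbling_number_def p_def)
  \<comment> \<open>Here \<open>t\<close> is fixed and is the index being bounded, so the estimate
    holds for every positive \<open>m\<close> and passes to the limit inferior.\<close>
  have lower: "ereal ((p t - C) / real t) \<le> ?L" if "t > 0" for t
    unfolding L_def
  proof (rule Liminf_bounded, rule eventually_sequentiallyI[of 1])
    fix m :: nat assume "1 \<le> m"
    then show "ereal ((p t - C) / real t) \<le> ereal (p m / real m)"
      using scale[of m t] that by (simp add: field_simps)
  qed
  \<comment> \<open>Now the roles are exchanged: \<open>p m\<close> is bounded through the fixed
    \<open>p t\<close>, and the error \<open>C / m\<close> vanishes in the limit.\<close>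
  have upper: "?L \<le> ereal (p t / real t)" if "t > 0" for t
  proof -
    have "?L \<le> liminf (\<lambda>m. ereal (p t / real t + C / real m))"
      unfolding L_def
    proof (rule Liminf_mono, rule eventually_sequentiallyI[of 1])
      fix m :: nat assume "1 \<le> m"
      then show "ereal (p m / real m) \<le> ereal (p t / real t + C / real m)"
        using scale[of t m] that by (simp add: field_simps)
    qed
    also have "(\<lambda>m. p t / real t + C / real m) \<longlonglongrightarrow> p t / real t + 0"
      by (intro tendsto_add tendsto_const lim_const_over_n)
    then have "liminf (\<lambda>m. ereal (p t / real t + C / real m)) = ereal (p t / real t)"
      by (intro lim_imp_Liminf) simp_all
    finally show ?thesis .
  qed
  \<comment> \<open>The two bounds at \<open>t = 1\<close> are real, which rules out infinite
    values.\<close>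
  obtain l where l: "?L = ereal l"
    using lower[of 1] upper[of 1] by (cases ?L) auto
  have "\<bar>p t - l * real t\<bar> \<le> C" for t
  \<comment> \<open>Both bounds divide by \<open>t\<close>, so zero is handled by scaling from
    \<open>m = 1\<close>.\<close>
  proof (cases "t = 0")
    case True
    then show ?thesis
      using scale[of 1 0] by (simp add: p_def)
  next
    case False
    then show ?thesis
      using lower[of t] upper[of t] by (simp add: l field_simps)
  qed
  then have "\<forall>t. \<bar>ereal (real (optimal_pebbling_number G t)) - ?L * ereal (real t)\<bar> \<le> ereal C"
    by (simp add: l p_def)
  then show ?thesis
    by blast
qed

end
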